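(* Let $n\ge1$ and $d\ge0$ be integers, let $a<b$ be real numbers, and let $P,Q\in\mathbb{S}^{\frac n2(d+1)(d+4)}$ be positive semidefinite, partitioned as $$P=\begin{bmatrix}P_{11}&P_{12}\\P_{21}&P_{22}\end{bmatrix},\quad Q=\begin{bmatrix}Q_{11}&Q_{12}\\Q_{21}&Q_{22}\end{bmatrix},\qquad P_{11},Q_{11}\in\mathbb{S}^{n(d+1)}.$$ Let $g(x)=(x-a)(b-x)$, $Z_1(x)=Z_d(x)\otimes I_n$ and $Z_2(x,y)=Z_d(x,y)\otimes I_n$. If for some $\epsilon>0$ $$M(x)=Z_1(x)^T\left(P_{11}+g(x)Q_{11}\right)Z_1(x)+\epsilon I_n,$$ $$N(x,y)=Z_1(x)^T\left(P_{12}+g(x)Q_{12}\right)Z_2(x,y)+Z_2(y,x)^T\left(P_{21}+g(y)Q_{21}\right)Z_1(y)+\int_a^bZ_2(z,x)^T\left(P_{22}+g(z)Q_{22}\right)Z_2(z,y)\,dz,$$ then the functional $V:L_2^n(a,b)\to\mathbb{R}$ defined by $$V(w)=\int_a^bw(x)^TM(x)w(x)\,dx+\int_a^bw(x)^T\int_a^bN(x,y)w(y)\,dy\,dx$$ satisfies $V(w)\ge\epsilon\|w\|_{L_2^n}^2$ for all $w\in L_2^n(a,b)$.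
   Context: $\mathbb{S}^k$ is the set of real symmetric $k\times k$ matrices, $I_n$ the $n\times n$ identity, $\otimes$ the Kronecker product. $L_2^n(a,b)$ is the Hilbert space of square integrable functions $(a,b)\to\mathbb{R}^n$ with norm $\|w\|_{L_2^n}=\left(\int_a^bw(x)^Tw(x)\,dx\right)^{1/2}$. $Z_d(x)$ is the column vector of all monomials in $x$ of degree at most $d$ (length $d+1$), and $Z_d(x,y)$ is the column vector of all monomials in $(x,y)$ of total degree at most $d$ (length $(d+1)(d+2)/2$). *)

theory Defs
  imports "HOL-Analysis.Analysis" "Jordan_Normal_Form.Matrix"
begin

text \<open>Vectors and matrices are those of \<^theory>\<open>Jordan_Normal_Form.Matrix\<close>. The symbols for indexing
  and for the inner product are also claimed by \<^theory>\<open>HOL-Analysis.Analysis\<close>, so the latter's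
  readings are switched off.\<close>

unbundle no vec_syntax
unbundle no inner_syntax

definition symmetric_mats :: "nat \<Rightarrow> real Matrix.mat set" where
  "symmetric_mats k = {A \<in> carrier_mat k k. A\<^sup>T = A}"

definition psd :: "real Matrix.mat \<Rightarrow> bool" where
  "psd A \<longleftrightarrow> A \<in> symmetric_mats (dim_row A) \<and>
     (\<forall>v \<in> carrier_vec (dim_row A). v \<bullet> (A *\<^sub>v v) \<ge> 0)"

definition kronecker :: "real Matrix.mat \<Rightarrow> real Matrix.mat \<Rightarrow> real Matrix.mat" (infixl \<open>\<otimes>\<^sub>K\<close> 72) where
  "A \<otimes>\<^sub>K B = Matrix.mat (dim_row A * dim_row B) (dim_col A * dim_col B)
     (\<lambda>(i, j). A $$ (i div dim_row B, j div dim_col B) * B $$ (i mod dim_row B, j mod dim_col B))"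

text \<open>Monomial vectors are matrices with one column. In one variable the monomials are ordered by
  degree; in two variables by total degree, and then by increasing exponent of the second variable:
  \<open>1, x, y, x^2, x y, y^2, \<dots>\<close>.\<close>

definition monomials1 :: "nat \<Rightarrow> real \<Rightarrow> real Matrix.mat" where
  "monomials1 d x = Matrix.mat (d + 1) 1 (\<lambda>(i, _). x ^ i)"

definition exponents2 :: "nat \<Rightarrow> (nat \<times> nat) list" where
  "exponents2 d = concat (map (\<lambda>k. map (\<lambda>j. (k - j, j)) [0..<k + 1]) [0..<d + 1])"

definition monomials2 :: "nat \<Rightarrow> real \<Rightarrow> real \<Rightarrow> real Matrix.mat" where
  "monomials2 d x y = Matrix.mat (length (exponents2 d)) 1
     (\<lambda>(i, _). x ^ fst (exponents2 d ! i) * y ^ snd (exponents2 d ! i))"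

lemma set_exponents2: "set (exponents2 d) = {(i, j). i + j \<le> d}"
proof -
  have upt: "{0..<k + 1} = {..k}" for k :: nat by auto
  have "set (exponents2 d) = (\<Union>k\<in>{..d}. (\<lambda>j. (k - j, j)) ` {..k})"
    by (simp only: exponents2_def set_concat set_map set_upt upt image_image)
  also have "\<dots> = {(i, j). i + j \<le> d}"
  proof (intro equalityI subsetI)
    fix p assume "p \<in> {(i, j). i + j \<le> d}"
    then obtain i j where "p = (i, j)" "i + j \<le> d" by auto
    then show "p \<in> (\<Union>k\<in>{..d}. (\<lambda>j. (k - j, j)) ` {..k})"
      by (intro UN_I[of "i + j"] image_eqI[of _ _ j]) auto
  qed auto
  finally show ?thesis .
qed

lemma length_exponents2: "length (exponents2 d) = (d + 1) * (d + 2) div 2"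
  by (induction d) (auto simp: exponents2_def)

lemma distinct_exponents2: "distinct (exponents2 d)"
proof (rule card_distinct)
  have "{(i, j). i + j \<le> d} = (SIGMA i:{..d}. {..d - i})" by auto
  then have "card (set (exponents2 d)) = (\<Sum>i\<le>d. d - i + 1)"
    by (simp add: set_exponents2)
  also have "\<dots> = (\<Sum>i\<le>d. i + 1)"
    using sum.atLeastAtMost_rev[of "\<lambda>i. i + 1" 0 d] by (simp add: atLeast0AtMost)
  also have "\<dots> = length (exponents2 d)"
    unfolding length_exponents2 by (induction d) auto
  finally show "card (set (exponents2 d)) = length (exponents2 d)" .
qed

text \<open>Integrals over an interval of vector- and matrix-valued functions are taken entrywise.\<close>

definition vec_integral :: "nat \<Rightarrow> real \<Rightarrow> real \<Rightarrow> (real \<Rightarrow> real Matrix.vec) \<Rightarrow> real Matrix.vec" where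
  "vec_integral n a b f = Matrix.vec n (\<lambda>i. LINT x:{a<..<b}|lebesgue. f x $ i)"

definition mat_integral :: "nat \<Rightarrow> nat \<Rightarrow> real \<Rightarrow> real \<Rightarrow> (real \<Rightarrow> real Matrix.mat) \<Rightarrow> real Matrix.mat" where
  "mat_integral m n a b F = Matrix.mat m n (\<lambda>ij. LINT x:{a<..<b}|lebesgue. F x $$ ij)"

text \<open>Elements of \<open>L\<^sub>2\<close> are represented by functions rather than by classes of functions equal almost
  everywhere; the values outside the interval are irrelevant.\<close>

definition L2 :: "nat \<Rightarrow> real \<Rightarrow> real \<Rightarrow> (real \<Rightarrow> real Matrix.vec) set" where
  "L2 n a b = {w. (\<forall>x \<in> {a<..<b}. w x \<in> carrier_vec n) \<and>
     (\<forall>i<n. set_borel_measurable lebesgue {a<..<b} (\<lambda>x. w x $ i)) \<and>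
     set_integrable lebesgue {a<..<b} (\<lambda>x. w x \<bullet> w x)}"

definition L2_norm :: "real \<Rightarrow> real \<Rightarrow> (real \<Rightarrow> real Matrix.vec) \<Rightarrow> real" where
  "L2_norm a b w = sqrt (LINT x:{a<..<b}|lebesgue. w x \<bullet> w x)"

end

theory Submission
  imports Defs
begin

text \<open>The point is that \<open>V w - \<epsilon> \<parallel>w\<parallel>\<^sup>2\<close> is the integral over \<open>z\<close> of the pointwise quadratic form
  \<open>v(z)\<^sup>T (P + g(z) Q) v(z)\<close>, where the vector \<open>v(z)\<close> stacks the local part \<open>u(z) = Z1(z) w(z)\<close> on
  top of the nonlocal part \<open>h(z) = \<integral> Z2(z,y) w(y) dy\<close>. Since \<open>P\<close> and \<open>Q\<close> are positive semidefinite
  and \<open>g \<ge> 0\<close> on \<open>(a,b)\<close>, the integrand is nonnegative.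

  Expanding the form along the block partition gives four terms. The \<open>11\<close> block is the multiplier
  part \<open>M - \<epsilon> I\<close>; the other three must be recognised as the double integral with kernel \<open>N\<close>, which
  would in general require interchanging integrals. The interchange is avoided because monomials
  separate: \<open>Z2(x,y) = D(x) E(y)\<close> with \<open>D\<close> diagonal and \<open>E(y) = Z2(1,y)\<close>
  (\<open>monomials2_kronecker_factor\<close>). So \<open>h(z) = D(z) m\<close> with one constant moment vector
  \<open>m = \<integral> E(y) w(y) dy\<close>, and all iterated integrals collapse to single ones in which constant vectors
  and matrices are moved through the integral sign. This identity is \<open>separable_kernel_form\<close>, the
  core of the proof; \<open>psd_block_form_nonneg\<close> supplies the sign.

  All integrability questions are settled by staying inside \<open>L\<^sub>2\<close>: it contains the constants, is
  closed under addition and under multiplication by continuous matrix functions, and inner products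
  of its members are integrable.\<close>

section \<open>Square integrable functions on an interval\<close>

lemma set_integral_sum:
  fixes f :: "'i \<Rightarrow> 'x \<Rightarrow> real"
  assumes "\<And>i. i \<in> J \<Longrightarrow> set_integrable M A (f i)"
  shows set_integrable_sum: "set_integrable M A (\<lambda>x. \<Sum>i\<in>J. f i x)"
    and "(LINT x:A|M. \<Sum>i\<in>J. f i x) = (\<Sum>i\<in>J. LINT x:A|M. f i x)"
  using assms unfolding set_integrable_def set_lebesgue_integral_def
  by (auto simp: scaleR_sum_right sum_distrib_left)

text \<open>The scalar case of \<open>L\<^sub>2\<close>, to which the vector case is reduced entry by entry.\<close>

definition square_integrable :: "real \<Rightarrow> real \<Rightarrow> (real \<Rightarrow> real) \<Rightarrow> bool" where
  "square_integrable a b f \<longleftrightarrow> set_borel_measurable lebesgue {a<..<b} f \<and>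
     set_integrable lebesgue {a<..<b} (\<lambda>x. (f x)\<^sup>2)"

lemma square_integrable_cong:
  assumes "\<And>x. x \<in> {a<..<b} \<Longrightarrow> f x = g x"
  shows "square_integrable a b f \<longleftrightarrow> square_integrable a b g"
proof -
  have "(\<lambda>x. indicator {a<..<b} x *\<^sub>R f x) = (\<lambda>x. indicator {a<..<b} x *\<^sub>R g x)"
    using assms by (auto simp: indicator_def fun_eq_iff)
  moreover have "set_integrable lebesgue {a<..<b} (\<lambda>x. (f x)\<^sup>2) =
      set_integrable lebesgue {a<..<b} (\<lambda>x. (g x)\<^sup>2)"
    using assms by (intro set_integrable_cong) auto
  ultimately show ?thesis by (simp add: square_integrable_def set_borel_measurable_def)
qed

lemma set_borel_measurable_mult:
  fixes f g :: "real \<Rightarrow> real"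
  assumes "set_borel_measurable M A f" "set_borel_measurable M A g"
  shows "set_borel_measurable M A (\<lambda>x. f x * g x)"
proof -
  have "(\<lambda>x. indicator A x *\<^sub>R (f x * g x)) =
      (\<lambda>x. (indicator A x *\<^sub>R f x) * (indicator A x *\<^sub>R g x))"
    by (auto simp: indicator_def fun_eq_iff)
  with assms show ?thesis
    unfolding set_borel_measurable_def by simp
qed

text \<open>The product is dominated by \<open>f\<^sup>2 + g\<^sup>2\<close>.\<close>

lemma square_integrable_mult_integrable:
  assumes "square_integrable a b f" "square_integrable a b g"
  shows "set_integrable lebesgue {a<..<b} (\<lambda>x. f x * g x)"
proof (rule set_integrable_bound)
  show "set_integrable lebesgue {a<..<b} (\<lambda>x. (f x)\<^sup>2 + (g x)\<^sup>2)"
    using assms by (auto simp: square_integrable_def)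
  show "set_borel_measurable lebesgue {a<..<b} (\<lambda>x. f x * g x)"
    using assms by (auto simp: square_integrable_def intro: set_borel_measurable_mult)
  have "\<bar>s * t\<bar> \<le> s\<^sup>2 + t\<^sup>2" for s t :: real
    using sum_squares_bound[of "\<bar>s\<bar>" "\<bar>t\<bar>", unfolded power2_abs]
      mult_nonneg_nonneg[of "\<bar>s\<bar>" "\<bar>t\<bar>"]
    unfolding abs_mult by linarith
  then show "AE x in lebesgue. x \<in> {a<..<b} \<longrightarrow> norm (f x * g x) \<le> norm ((f x)\<^sup>2 + (g x)\<^sup>2)"
    by auto
qed

lemma square_integrable_add:
  assumes "square_integrable a b f" "square_integrable a b g"
  shows "square_integrable a b (\<lambda>x. f x + g x)"
proof -
  have "set_integrable lebesgue {a<..<b} (\<lambda>x. (f x)\<^sup>2 + (g x)\<^sup>2 + 2 * (f x * g x))"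
    using assms square_integrable_mult_integrable[OF assms]
    by (intro set_integral_add set_integrable_mult_right) (auto simp: square_integrable_def)
  then show ?thesis
    using assms unfolding square_integrable_def set_borel_measurable_def
    by (auto simp: power2_sum distrib_left mult.assoc)
qed

lemma square_integrable_zero: "square_integrable a b (\<lambda>_. 0)"
  by (simp add: square_integrable_def set_borel_measurable_def set_integrable_def)

lemma square_integrable_sum:
  assumes "finite J" "\<And>j. j \<in> J \<Longrightarrow> square_integrable a b (f j)"
  shows "square_integrable a b (\<lambda>x. \<Sum>j\<in>J. f j x)"
  using assms by (induction J) (auto simp: square_integrable_zero square_integrable_add)

lemma square_integrable_continuous:
  assumes "continuous_on {a..b} f"
  shows "square_integrable a b f"
proof -
  have int: "set_integrable lebesgue {a<..<b} h" if h: "continuous_on {a..b} h" for h :: "real \<Rightarrow> real"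
  proof (rule set_integrable_subset)
    have "integrable lborel (\<lambda>x. indicator {a..b} x *\<^sub>R h x)"
      using h by (intro borel_integrable_compact) auto
    then show "set_integrable lebesgue {a..b} h"
      unfolding set_integrable_def
      using integrable_completion[OF borel_measurable_integrable] by blast
  qed auto
  have "set_integrable lebesgue {a<..<b} (\<lambda>x. (f x)\<^sup>2)"
    using assms by (intro int continuous_intros)
  with int[OF assms] show ?thesis
    by (auto simp: square_integrable_def set_borel_measurable_def set_integrable_def)
qed

text \<open>Continuity is required up to the end points: it bounds the factor by compactness.\<close>

lemma square_integrable_continuous_mult:
  assumes c: "continuous_on {a..b} c" and f: "square_integrable a b f"
  shows "square_integrable a b (\<lambda>x. c x * f x)"
proof -
  have "bounded (c ` {a..b})"
    using c by (intro compact_imp_bounded compact_continuous_image) auto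
  then obtain B where B: "\<And>x. x \<in> {a..b} \<Longrightarrow> \<bar>c x\<bar> \<le> B"
    unfolding bounded_iff by fastforce
  have meas: "set_borel_measurable lebesgue {a<..<b} (\<lambda>x. c x * f x)"
    using f square_integrable_continuous[OF c]
    by (auto simp: square_integrable_def intro: set_borel_measurable_mult)
  have "set_integrable lebesgue {a<..<b} (\<lambda>x. (c x * f x)\<^sup>2)"
  proof (rule set_integrable_bound)
    show "set_integrable lebesgue {a<..<b} (\<lambda>x. B\<^sup>2 * (f x)\<^sup>2)"
      using f by (auto simp: square_integrable_def)
    show "set_borel_measurable lebesgue {a<..<b} (\<lambda>x. (c x * f x)\<^sup>2)"
      using meas set_borel_measurable_mult by (simp add: power2_eq_square)
    have "(c x * f x)\<^sup>2 \<le> B\<^sup>2 * (f x)\<^sup>2" if "x \<in> {a<..<b}" for x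
      using B[of x] that by (auto simp: power_mult_distrib abs_le_square_iff[symmetric]
          intro!: mult_right_mono)
    then show "AE x in lebesgue. x \<in> {a<..<b} \<longrightarrow>
        norm ((c x * f x)\<^sup>2) \<le> norm (B\<^sup>2 * (f x)\<^sup>2)"
      by (auto simp: abs_mult)
  qed
  with meas show ?thesis by (simp add: square_integrable_def)
qed

text \<open>Each squared entry is dominated by \<open>w \<bullet> w\<close>, and \<open>w \<bullet> w\<close> is the finite sum of the squared
  entries.\<close>

lemma L2_iff_square_integrable:
  "w \<in> L2 n a b \<longleftrightarrow> (\<forall>x\<in>{a<..<b}. w x \<in> carrier_vec n) \<and>
     (\<forall>i<n. square_integrable a b (\<lambda>x. w x $ i))"
proof (cases "(\<forall>x\<in>{a<..<b}. w x \<in> carrier_vec n) \<and>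
    (\<forall>i<n. set_borel_measurable lebesgue {a<..<b} (\<lambda>x. w x $ i))")
  case True
  then have carrier: "\<And>x. x \<in> {a<..<b} \<Longrightarrow> w x \<in> carrier_vec n"
    and meas: "\<And>i. i < n \<Longrightarrow> set_borel_measurable lebesgue {a<..<b} (\<lambda>x. w x $ i)" by auto
  have inner: "w x \<bullet> w x = (\<Sum>i<n. (w x $ i)\<^sup>2)" if "x \<in> {a<..<b}" for x
    using carrier[OF that] by (auto simp: scalar_prod_def power2_eq_square atLeast0LessThan)
  have "set_integrable lebesgue {a<..<b} (\<lambda>x. w x \<bullet> w x) \<longleftrightarrow>
      set_integrable lebesgue {a<..<b} (\<lambda>x. \<Sum>i<n. (w x $ i)\<^sup>2)"
    by (rule set_integrable_cong) (auto simp: inner)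
  also have "\<dots> \<longleftrightarrow> (\<forall>i<n. set_integrable lebesgue {a<..<b} (\<lambda>x. (w x $ i)\<^sup>2))"
  proof (intro iffI allI impI)
    fix i assume sum: "set_integrable lebesgue {a<..<b} (\<lambda>x. \<Sum>i<n. (w x $ i)\<^sup>2)" and i: "i < n"
    show "set_integrable lebesgue {a<..<b} (\<lambda>x. (w x $ i)\<^sup>2)"
    proof (rule set_integrable_bound[OF sum])
      show "set_borel_measurable lebesgue {a<..<b} (\<lambda>x. (w x $ i)\<^sup>2)"
        using set_borel_measurable_mult[OF meas[OF i] meas[OF i]] by (simp add: power2_eq_square)
      have "(w x $ i)\<^sup>2 \<le> (\<Sum>i<n. (w x $ i)\<^sup>2)" for x
        using i by (intro member_le_sum) auto
      then show "AE x in lebesgue. x \<in> {a<..<b} \<longrightarrow>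
          norm ((w x $ i)\<^sup>2) \<le> norm (\<Sum>i<n. (w x $ i)\<^sup>2)"
        by (auto intro: order_trans[OF _ abs_ge_self])
    qed
  qed (auto intro: set_integrable_sum)
  finally show ?thesis
    using True by (auto simp: L2_def square_integrable_def)
qed (auto simp: L2_def square_integrable_def)

section \<open>Integrals of vector- and matrix-valued functions\<close>

lemma L2_carrier: "w \<in> L2 n a b \<Longrightarrow> x \<in> {a<..<b} \<Longrightarrow> w x \<in> carrier_vec n"
  by (simp add: L2_def)

lemma L2_dim: "w \<in> L2 n a b \<Longrightarrow> a < x \<Longrightarrow> x < b \<Longrightarrow> dim_vec (w x) = n"
  using L2_carrier[of w n a b x] by simp

lemma L2_const:
  assumes "v \<in> carrier_vec n"
  shows "(\<lambda>_. v) \<in> L2 n a b"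
  using assms by (auto simp: L2_iff_square_integrable intro: square_integrable_continuous)

lemma L2_inner_integrable:
  assumes u: "u \<in> L2 n a b" and v: "v \<in> L2 n a b"
  shows "set_integrable lebesgue {a<..<b} (\<lambda>x. u x \<bullet> v x)"
proof -
  have "set_integrable lebesgue {a<..<b} (\<lambda>x. \<Sum>i<n. u x $ i * v x $ i)"
    using u v by (intro set_integrable_sum square_integrable_mult_integrable)
      (auto simp: L2_iff_square_integrable)
  moreover have "u x \<bullet> v x = (\<Sum>i<n. u x $ i * v x $ i)" if "x \<in> {a<..<b}" for x
    using L2_carrier[OF v that] by (simp add: scalar_prod_def atLeast0LessThan)
  ultimately show ?thesis
    by (subst set_integrable_cong[OF refl refl]) auto
qed

text \<open>An entry is its product with the constant \<open>1\<close>, which is square integrable since the interval is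
  bounded.\<close>

lemma L2_entry_integrable:
  assumes "w \<in> L2 n a b" "i < n"
  shows "set_integrable lebesgue {a<..<b} (\<lambda>x. w x $ i)"
  using square_integrable_mult_integrable[of a b "\<lambda>_. 1" "\<lambda>x. w x $ i"] assms
  by (auto simp: L2_iff_square_integrable square_integrable_continuous)

lemma L2_add:
  assumes "u \<in> L2 n a b" "v \<in> L2 n a b"
  shows "(\<lambda>x. u x + v x) \<in> L2 n a b"
proof -
  have "square_integrable a b (\<lambda>x. (u x + v x) $ i)" if "i < n" for i
  proof -
    have "square_integrable a b (\<lambda>x. u x $ i + v x $ i)"
      using assms that by (auto simp: L2_iff_square_integrable intro: square_integrable_add)
    moreover have "(u x + v x) $ i = u x $ i + v x $ i" if "x \<in> {a<..<b}" for x
      using L2_carrier[OF assms(2) that] \<open>i < n\<close> by simp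
    ultimately show ?thesis
      by (subst square_integrable_cong) auto
  qed
  then show ?thesis
    using assms by (auto simp: L2_iff_square_integrable)
qed

text \<open>The dimensions are fixed at every point and not only on \<open>S\<close>: matrix identities then hold without
  side conditions on the argument.\<close>

definition continuous_mat_on ::
    "real set \<Rightarrow> nat \<Rightarrow> nat \<Rightarrow> (real \<Rightarrow> real Matrix.mat) \<Rightarrow> bool" where
  "continuous_mat_on S nr nc F \<longleftrightarrow> (\<forall>x. F x \<in> carrier_mat nr nc) \<and>
     (\<forall>i<nr. \<forall>j<nc. continuous_on S (\<lambda>x. F x $$ (i, j)))"

lemma continuous_mat_on_carrier: "continuous_mat_on S nr nc F \<Longrightarrow> F x \<in> carrier_mat nr nc"
  by (simp add: continuous_mat_on_def)

lemma continuous_mat_on_const: "A \<in> carrier_mat nr nc \<Longrightarrow> continuous_mat_on S nr nc (\<lambda>_. A)"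
  by (simp add: continuous_mat_on_def)

lemma continuous_mat_on_transpose:
  assumes "continuous_mat_on S nr nc F"
  shows "continuous_mat_on S nc nr (\<lambda>x. (F x)\<^sup>T)"
proof -
  have "(F x)\<^sup>T $$ (j, i) = F x $$ (i, j)" if "i < nr" "j < nc" for x i j
    using continuous_mat_on_carrier[OF assms, of x] that by simp
  with assms show ?thesis by (simp add: continuous_mat_on_def)
qed

lemma continuous_mat_on_add_smult:
  fixes c :: "real \<Rightarrow> real"
  assumes A: "A \<in> carrier_mat nr nc" and B: "B \<in> carrier_mat nr nc" and c: "continuous_on S c"
  shows "continuous_mat_on S nr nc (\<lambda>x. A + c x \<cdot>\<^sub>m B)"
  using assms by (auto simp: continuous_mat_on_def intro!: continuous_intros)

lemma continuous_mat_on_mult: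
  assumes F: "continuous_mat_on S nr n F" and G: "continuous_mat_on S n nc G"
  shows "continuous_mat_on S nr nc (\<lambda>x. F x * G x)"
proof -
  have "continuous_on S (\<lambda>x. (F x * G x) $$ (i, j))" if ij: "i < nr" "j < nc" for i j
  proof -
    have "(F x * G x) $$ (i, j) = (\<Sum>k<n. F x $$ (i, k) * G x $$ (k, j))" for x
      using continuous_mat_on_carrier[OF F, of x] continuous_mat_on_carrier[OF G, of x] ij
      by (simp add: scalar_prod_def atLeast0LessThan)
    then show ?thesis
      using F G ij by (auto simp: continuous_mat_on_def intro!: continuous_intros)
  qed
  moreover have "F x * G x \<in> carrier_mat nr nc" for x
    using F G by (intro mult_carrier_mat continuous_mat_on_carrier)
  ultimately show ?thesis
    by (simp add: continuous_mat_on_def)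
qed

lemma continuous_mat_on_mult_L2:
  assumes F: "continuous_mat_on {a..b} m n F" and w: "w \<in> L2 n a b"
  shows "(\<lambda>x. F x *\<^sub>v w x) \<in> L2 m a b"
proof -
  have "square_integrable a b (\<lambda>x. (F x *\<^sub>v w x) $ i)" if i: "i < m" for i
  proof -
    have "square_integrable a b (\<lambda>x. \<Sum>j<n. F x $$ (i, j) * w x $ j)"
      using F w i by (intro square_integrable_sum square_integrable_continuous_mult)
        (auto simp: continuous_mat_on_def L2_iff_square_integrable)
    moreover have "(F x *\<^sub>v w x) $ i = (\<Sum>j<n. F x $$ (i, j) * w x $ j)"
      if "x \<in> {a<..<b}" for x
      using continuous_mat_on_carrier[OF F, of x] L2_carrier[OF w that] i
      by (simp add: scalar_prod_def atLeast0LessThan)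
    ultimately show ?thesis
      by (subst square_integrable_cong) auto
  qed
  moreover have "F x *\<^sub>v w x \<in> carrier_vec m" for x
    using continuous_mat_on_carrier[OF F, of x] by (intro carrier_vecI) simp
  ultimately show ?thesis
    by (simp add: L2_iff_square_integrable)
qed

lemma vec_integral_carrier: "vec_integral n a b f \<in> carrier_vec n"
  by (simp add: vec_integral_def)

lemma mat_integral_carrier: "mat_integral m n a b F \<in> carrier_mat m n"
  by (simp add: mat_integral_def)

lemma vec_integral_cong:
  assumes "\<And>x. x \<in> {a<..<b} \<Longrightarrow> f x = g x"
  shows "vec_integral n a b f = vec_integral n a b g"
  using assms unfolding vec_integral_def
  by (intro eq_vecI) (auto intro: set_lebesgue_integral_cong)

lemma vec_integral_add:
  assumes "u \<in> L2 n a b" "v \<in> L2 n a b"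
  shows "vec_integral n a b (\<lambda>x. u x + v x) = vec_integral n a b u + vec_integral n a b v"
proof (rule eq_vecI)
  fix i assume "i < dim_vec (vec_integral n a b u + vec_integral n a b v)"
  then have i: "i < n" by (simp add: vec_integral_def)
  have "(LINT x:{a<..<b}|lebesgue. (u x + v x) $ i) =
      (LINT x:{a<..<b}|lebesgue. u x $ i + v x $ i)"
    using L2_dim[OF assms(2)] i by (intro set_lebesgue_integral_cong) auto
  also have "\<dots> = (LINT x:{a<..<b}|lebesgue. u x $ i) + (LINT x:{a<..<b}|lebesgue. v x $ i)"
    using assms i by (intro set_integral_add L2_entry_integrable)
  finally show "vec_integral n a b (\<lambda>x. u x + v x) $ i =
      (vec_integral n a b u + vec_integral n a b v) $ i"
    using i by (simp add: vec_integral_def)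
qed (simp add: vec_integral_def)

text \<open>Constant vectors, and hence constant matrices, pass through the entrywise integral. These rules
  replace Fubini's theorem below.\<close>

lemma scalar_prod_vec_integral:
  assumes u: "u \<in> carrier_vec n" and f: "f \<in> L2 n a b"
  shows "u \<bullet> vec_integral n a b f = (LINT x:{a<..<b}|lebesgue. u \<bullet> f x)"
proof -
  have "(LINT x:{a<..<b}|lebesgue. u \<bullet> f x) =
      (LINT x:{a<..<b}|lebesgue. \<Sum>i<n. u $ i * f x $ i)"
    using L2_dim[OF f] by (intro set_lebesgue_integral_cong)
      (auto simp: scalar_prod_def atLeast0LessThan)
  also have "\<dots> = (\<Sum>i<n. u $ i * (LINT x:{a<..<b}|lebesgue. f x $ i))"
    using f by (subst set_integral_sum(2)) (auto simp: L2_entry_integrable)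
  also have "\<dots> = u \<bullet> vec_integral n a b f"
    by (simp add: vec_integral_def scalar_prod_def atLeast0LessThan)
  finally show ?thesis ..
qed

lemma vec_integral_mult_mat:
  assumes A: "A \<in> carrier_mat m n" and f: "f \<in> L2 n a b"
  shows "vec_integral m a b (\<lambda>x. A *\<^sub>v f x) = A *\<^sub>v vec_integral n a b f"
proof (rule eq_vecI)
  fix i assume "i < dim_vec (A *\<^sub>v vec_integral n a b f)"
  with A have i: "i < m" by simp
  have "(A *\<^sub>v vec_integral n a b f) $ i = Matrix.row A i \<bullet> vec_integral n a b f"
    using A i by simp
  also have "\<dots> = (LINT x:{a<..<b}|lebesgue. Matrix.row A i \<bullet> f x)"
    using A f i by (intro scalar_prod_vec_integral) auto
  also have "\<dots> = vec_integral m a b (\<lambda>x. A *\<^sub>v f x) $ i"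
    using A i by (simp add: vec_integral_def)
  finally show "vec_integral m a b (\<lambda>x. A *\<^sub>v f x) $ i = (A *\<^sub>v vec_integral n a b f) $ i" ..
qed (use A in \<open>simp add: vec_integral_def\<close>)

lemma mat_integral_mult_vec:
  assumes F: "continuous_mat_on {a..b} m n F" and v: "v \<in> carrier_vec n"
  shows "mat_integral m n a b F *\<^sub>v v = vec_integral m a b (\<lambda>x. F x *\<^sub>v v)"
proof (rule eq_vecI)
  fix i assume "i < dim_vec (vec_integral m a b (\<lambda>x. F x *\<^sub>v v))"
  then have i: "i < m" by (simp add: vec_integral_def)
  have row_entry: "Matrix.row (F x) i $ j = F x $$ (i, j)" if "j < n" for x j
    using i that continuous_mat_on_carrier[OF F, of x] by simp
  then have row: "(\<lambda>x. Matrix.row (F x) i) \<in> L2 n a b"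
    using F i continuous_mat_on_carrier[OF F]
    by (auto simp: L2_iff_square_integrable continuous_mat_on_def
        intro!: square_integrable_continuous)
  have "(mat_integral m n a b F *\<^sub>v v) $ i = vec_integral n a b (\<lambda>x. Matrix.row (F x) i) \<bullet> v"
    using v i row_entry
    by (auto simp: mat_integral_def vec_integral_def scalar_prod_def intro!: sum.cong)
  also have "\<dots> = v \<bullet> vec_integral n a b (\<lambda>x. Matrix.row (F x) i)"
    using v by (intro comm_scalar_prod[OF vec_integral_carrier])
  also have "\<dots> = (LINT x:{a<..<b}|lebesgue. v \<bullet> Matrix.row (F x) i)"
    by (rule scalar_prod_vec_integral[OF v row])
  also have "\<dots> = (LINT x:{a<..<b}|lebesgue. Matrix.row (F x) i \<bullet> v)"
    using comm_scalar_prod[OF v L2_carrier[OF row]]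
    by (intro set_lebesgue_integral_cong) auto
  also have "\<dots> = vec_integral m a b (\<lambda>x. F x *\<^sub>v v) $ i"
    using i by (simp add: vec_integral_def carrier_matD(1)[OF continuous_mat_on_carrier[OF F]])
  finally show "(mat_integral m n a b F *\<^sub>v v) $ i = vec_integral m a b (\<lambda>x. F x *\<^sub>v v) $ i" .
qed (simp add: mat_integral_def vec_integral_def)

text \<open>An entry of \<open>A * G * B\<close> is the bilinear form of \<open>G\<close> at a row of \<open>A\<close> and a column of \<open>B\<close>, so both
  outer factors are pulled out by the vector rules.\<close>

lemma mat_integral_mult:
  assumes A: "A \<in> carrier_mat k m" and F: "continuous_mat_on {a..b} m n F"
    and B: "B \<in> carrier_mat n l"
  shows "mat_integral k l a b (\<lambda>x. A * F x * B) = A * mat_integral m n a b F * B"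
proof (rule eq_matI)
  fix i j assume "i < dim_row (A * mat_integral m n a b F * B)"
    "j < dim_col (A * mat_integral m n a b F * B)"
  with A B have i: "i < k" and j: "j < l" by auto
  have row: "Matrix.row A i \<in> carrier_vec m" and col: "Matrix.col B j \<in> carrier_vec n"
    using A B i j by auto
  have entry: "(A * G * B) $$ (i, j) = Matrix.row A i \<bullet> (G *\<^sub>v Matrix.col B j)"
    if "G \<in> carrier_mat m n" for G
    using A B i j that assoc_mult_mat[OF A that B] by (simp add: col_mult2[OF that B j])
  have "(A * mat_integral m n a b F * B) $$ (i, j) =
      Matrix.row A i \<bullet> vec_integral m a b (\<lambda>x. F x *\<^sub>v Matrix.col B j)"
    by (simp add: entry mat_integral_carrier mat_integral_mult_vec[OF F col])
  also have "\<dots> = (LINT x:{a<..<b}|lebesgue. Matrix.row A i \<bullet> (F x *\<^sub>v Matrix.col B j))"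
    by (intro scalar_prod_vec_integral row continuous_mat_on_mult_L2[OF F] L2_const col)
  also have "\<dots> = mat_integral k l a b (\<lambda>x. A * F x * B) $$ (i, j)"
    using i j by (simp add: mat_integral_def entry continuous_mat_on_carrier[OF F])
  finally show "mat_integral k l a b (\<lambda>x. A * F x * B) $$ (i, j) =
      (A * mat_integral m n a b F * B) $$ (i, j)" ..
qed (use A B in \<open>auto simp: mat_integral_def\<close>)

section \<open>Quadratic forms with a separable kernel\<close>

lemma scalar_prod_transpose_mult:
  fixes B :: "real Matrix.mat"
  assumes "B \<in> carrier_mat m n" "u \<in> carrier_vec n" "v \<in> carrier_vec m"
  shows "u \<bullet> (B\<^sup>T *\<^sub>v v) = (B *\<^sub>v u) \<bullet> v"
proof -
  have "u \<bullet> (B\<^sup>T *\<^sub>v v) = (B\<^sup>T *\<^sub>v v) \<bullet> u"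
    using assms by (intro comm_scalar_prod[of _ n]) auto
  also have "\<dots> = v \<bullet> (B *\<^sub>v u)"
    using assms by (intro transpose_vec_mult_scalar)
  also have "\<dots> = (B *\<^sub>v u) \<bullet> v"
    using assms by (intro comm_scalar_prod[of _ m]) auto
  finally show ?thesis .
qed

text \<open>With the moment vector \<open>m = \<integral> E w\<close> and \<open>k = \<integral> D\<^sup>T R21 A w\<close>, the inner integral at \<open>x\<close> is
  \<open>A(x)\<^sup>T R12(x) D(x) m + E(x)\<^sup>T k + E(x)\<^sup>T C m\<close> with the constant matrix \<open>C = \<integral> D\<^sup>T R22 D\<close>. Pairing with
  \<open>w\<close> and integrating turns the last two terms into \<open>m \<bullet> k\<close> and \<open>m \<bullet> C m\<close>. Opening the integrals \<open>k\<close> and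
  \<open>C\<close> again, now with \<open>m\<close> inside, gives the terms in \<open>h = D m\<close>: the outer and inner integration have
  changed places.\<close>

lemma separable_kernel_form:
  fixes A D E R12 R21 R22 :: "real \<Rightarrow> real Matrix.mat"
  assumes A: "continuous_mat_on {a..b} p n A"
    and D: "continuous_mat_on {a..b} r q D"
    and E: "continuous_mat_on {a..b} q n E"
    and R12: "continuous_mat_on {a..b} p r R12"
    and R21: "continuous_mat_on {a..b} r p R21"
    and R22: "continuous_mat_on {a..b} r r R22"
    and w: "w \<in> L2 n a b"
    and N: "\<And>x y. N x y = (A x)\<^sup>T * R12 x * (D x * E y) + (D y * E x)\<^sup>T * R21 y * A y
       + mat_integral n n a b (\<lambda>z. (D z * E x)\<^sup>T * R22 z * (D z * E y))"
    and h: "\<And>x. h x = D x *\<^sub>v vec_integral q a b (\<lambda>y. E y *\<^sub>v w y)"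
  shows "(LINT x:{a<..<b}|lebesgue. w x \<bullet> vec_integral n a b (\<lambda>y. N x y *\<^sub>v w y)) =
    (LINT x:{a<..<b}|lebesgue. (A x *\<^sub>v w x) \<bullet> (R12 x *\<^sub>v h x)
       + h x \<bullet> (R21 x *\<^sub>v (A x *\<^sub>v w x)) + h x \<bullet> (R22 x *\<^sub>v h x))"
proof -
  note carriers = continuous_mat_on_carrier[OF A] continuous_mat_on_carrier[OF D]
    continuous_mat_on_carrier[OF E] continuous_mat_on_carrier[OF R12]
    continuous_mat_on_carrier[OF R21] continuous_mat_on_carrier[OF R22]
  define u where "u x = A x *\<^sub>v w x" for x
  define e where "e x = E x *\<^sub>v w x" for x
  define c where "c x = (D x)\<^sup>T *\<^sub>v (R21 x *\<^sub>v u x)" for x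
  define m where "m = vec_integral q a b e"
  define k where "k = vec_integral q a b c"
  define G where "G z = (D z)\<^sup>T * R22 z * D z" for z
  define C where "C = mat_integral q q a b G"
  have u: "u \<in> L2 p a b" and e: "e \<in> L2 q a b"
    using A E w by (simp_all add: u_def[abs_def] e_def[abs_def] continuous_mat_on_mult_L2)
  have R21u: "(\<lambda>x. R21 x *\<^sub>v u x) \<in> L2 r a b"
    by (intro continuous_mat_on_mult_L2[OF R21] u)
  have c: "c \<in> L2 q a b"
    unfolding c_def[abs_def]
    by (intro continuous_mat_on_mult_L2[OF continuous_mat_on_transpose[OF D]] R21u)
  have m: "m \<in> carrier_vec q" and k: "k \<in> carrier_vec q" and C: "C \<in> carrier_mat q q"
    by (simp_all add: m_def k_def C_def vec_integral_carrier mat_integral_carrier)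
  have h_eq: "h x = D x *\<^sub>v m" for x
    by (simp add: h m_def e_def[abs_def])
  have h_L2: "h \<in> L2 r a b"
    unfolding h_eq[abs_def] by (intro continuous_mat_on_mult_L2[OF D] L2_const m)
  have G: "continuous_mat_on {a..b} q q G"
    unfolding G_def[abs_def]
    by (rule continuous_mat_on_mult[OF
          continuous_mat_on_mult[OF continuous_mat_on_transpose[OF D] R22] D])
  \<comment> \<open>Separability reduces the integral inside the kernel to one constant matrix.\<close>
  have N_integral: "mat_integral n n a b (\<lambda>z. (D z * E x)\<^sup>T * R22 z * (D z * E y)) =
      (E x)\<^sup>T * C * E y" for x y
  proof -
    have "(D z * E x)\<^sup>T * R22 z * (D z * E y) = (E x)\<^sup>T * G z * E y" for z
    proof -
      have X: "(E x)\<^sup>T \<in> carrier_mat n q" and T: "(D z)\<^sup>T \<in> carrier_mat q r"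
        using carriers by auto
      note TR = mult_carrier_mat[OF T carriers(6)]
      have "(E x)\<^sup>T * G z = (E x)\<^sup>T * (D z)\<^sup>T * R22 z * D z"
        unfolding G_def assoc_mult_mat[OF X T carriers(6)]
        by (rule assoc_mult_mat[OF X TR carriers(2), symmetric])
      then show ?thesis
        unfolding transpose_mult[OF carriers(2,3)]
        by (simp only: assoc_mult_mat[OF mult_carrier_mat[OF mult_carrier_mat[OF X T] carriers(6)]
              carriers(2,3)])
    qed
    then show ?thesis
      unfolding C_def using carriers by (simp add: mat_integral_mult[OF _ G])
  qed
  have inner: "vec_integral n a b (\<lambda>y. N x y *\<^sub>v w y) =
      (A x)\<^sup>T *\<^sub>v (R12 x *\<^sub>v h x) + (E x)\<^sup>T *\<^sub>v k + (E x)\<^sup>T *\<^sub>v (C *\<^sub>v m)" for x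
  proof -
    define B where "B = (A x)\<^sup>T * R12 x * D x"
    have cx: "(A x)\<^sup>T \<in> carrier_mat n p" "R12 x \<in> carrier_mat p r" "D x \<in> carrier_mat r q"
      "(E x)\<^sup>T \<in> carrier_mat n q"
      using carriers by auto
    then have B: "B \<in> carrier_mat n q" and EC: "(E x)\<^sup>T * C \<in> carrier_mat n q"
      using C by (auto simp: B_def)
    have step: "N x y *\<^sub>v w y = B *\<^sub>v e y + (E x)\<^sup>T *\<^sub>v c y + ((E x)\<^sup>T * C) *\<^sub>v e y"
      if y: "y \<in> {a<..<b}" for y
    proof -
      have cy: "E y \<in> carrier_mat q n" "(D y)\<^sup>T \<in> carrier_mat q r" "R21 y \<in> carrier_mat r p"
        "A y \<in> carrier_mat p n"
        using carriers by auto
      have wy: "w y \<in> carrier_vec n"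
        by (rule L2_carrier[OF w y])
      have AR: "(A x)\<^sup>T * R12 x \<in> carrier_mat n r" and ED: "(E x)\<^sup>T * (D y)\<^sup>T \<in> carrier_mat n r"
        and EDR: "(E x)\<^sup>T * (D y)\<^sup>T * R21 y \<in> carrier_mat n p"
        using cx cy by (auto intro!: mult_carrier_mat)
      note Aw = mult_mat_vec_carrier[OF cy(4) wy]
      note RAw = mult_mat_vec_carrier[OF cy(3) Aw]
      note T1 = mult_carrier_mat[OF B cy(1)] and T2 = mult_carrier_mat[OF EDR cy(4)]
        and T3 = mult_carrier_mat[OF EC cy(1)]
      have "N x y = B * E y + (E x)\<^sup>T * (D y)\<^sup>T * R21 y * A y + (E x)\<^sup>T * C * E y"
        unfolding N N_integral
        by (simp only: B_def assoc_mult_mat[OF AR cx(3) cy(1)] transpose_mult[OF carriers(2,3)])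
      then have "N x y *\<^sub>v w y = (B * E y) *\<^sub>v w y
          + ((E x)\<^sup>T * (D y)\<^sup>T * R21 y * A y) *\<^sub>v w y + ((E x)\<^sup>T * C * E y) *\<^sub>v w y"
        by (simp only: add_mult_distrib_mat_vec[OF add_carrier_mat[OF T2] T3 wy]
            add_mult_distrib_mat_vec[OF T1 T2 wy])
      also have "(B * E y) *\<^sub>v w y = B *\<^sub>v e y"
        unfolding e_def by (rule assoc_mult_mat_vec[OF B cy(1) wy])
      also have "((E x)\<^sup>T * (D y)\<^sup>T * R21 y * A y) *\<^sub>v w y = (E x)\<^sup>T *\<^sub>v c y"
        by (simp only: c_def u_def assoc_mult_mat_vec[OF EDR cy(4) wy]
            assoc_mult_mat_vec[OF ED cy(3) Aw] assoc_mult_mat_vec[OF cx(4) cy(2) RAw])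
      also have "((E x)\<^sup>T * C * E y) *\<^sub>v w y = ((E x)\<^sup>T * C) *\<^sub>v e y"
        unfolding e_def by (rule assoc_mult_mat_vec[OF EC cy(1) wy])
      finally show ?thesis .
    qed
    note const_mult_L2 = continuous_mat_on_mult_L2[OF continuous_mat_on_const]
    note Be = const_mult_L2[OF B e] and Ec = const_mult_L2[OF cx(4) c]
      and ECe = const_mult_L2[OF EC e]
    have "vec_integral n a b (\<lambda>y. N x y *\<^sub>v w y) =
        vec_integral n a b (\<lambda>y. B *\<^sub>v e y + (E x)\<^sup>T *\<^sub>v c y + ((E x)\<^sup>T * C) *\<^sub>v e y)"
      by (rule vec_integral_cong[OF step])
    also have "\<dots> = B *\<^sub>v m + (E x)\<^sup>T *\<^sub>v k + ((E x)\<^sup>T * C) *\<^sub>v m"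
      unfolding m_def k_def vec_integral_add[OF L2_add[OF Be Ec] ECe] vec_integral_add[OF Be Ec]
        vec_integral_mult_mat[OF B e] vec_integral_mult_mat[OF cx(4) c]
        vec_integral_mult_mat[OF EC e] ..
    also have "B *\<^sub>v m = (A x)\<^sup>T *\<^sub>v (R12 x *\<^sub>v h x)"
      by (simp only: B_def h_eq assoc_mult_mat_vec[OF mult_carrier_mat[OF cx(1,2)] cx(3) m]
          assoc_mult_mat_vec[OF cx(1,2) mult_mat_vec_carrier[OF cx(3) m]])
    also have "((E x)\<^sup>T * C) *\<^sub>v m = (E x)\<^sup>T *\<^sub>v (C *\<^sub>v m)"
      by (rule assoc_mult_mat_vec[OF cx(4) C m])
    finally show ?thesis .
  qed
  have outer: "w x \<bullet> vec_integral n a b (\<lambda>y. N x y *\<^sub>v w y) =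
      u x \<bullet> (R12 x *\<^sub>v h x) + k \<bullet> e x + (C *\<^sub>v m) \<bullet> e x" if x: "x \<in> {a<..<b}" for x
  proof -
    have wx: "w x \<in> carrier_vec n" and hx: "h x \<in> carrier_vec r" and ex: "e x \<in> carrier_vec q"
      using L2_carrier[OF w x] L2_carrier[OF h_L2 x] L2_carrier[OF e x] by auto
    note Rh = mult_mat_vec_carrier[OF carriers(4) hx, of x] and Cm = mult_mat_vec_carrier[OF C m]
    have AT: "(A x)\<^sup>T \<in> carrier_mat n p" and ET: "(E x)\<^sup>T \<in> carrier_mat n q"
      using carriers by auto
    have v1: "(A x)\<^sup>T *\<^sub>v (R12 x *\<^sub>v h x) \<in> carrier_vec n"
      and v2: "(E x)\<^sup>T *\<^sub>v k \<in> carrier_vec n"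
      and v3: "(E x)\<^sup>T *\<^sub>v (C *\<^sub>v m) \<in> carrier_vec n"
      using mult_mat_vec_carrier[OF AT Rh] mult_mat_vec_carrier[OF ET k]
        mult_mat_vec_carrier[OF ET Cm] by auto
    have "w x \<bullet> vec_integral n a b (\<lambda>y. N x y *\<^sub>v w y) =
        w x \<bullet> ((A x)\<^sup>T *\<^sub>v (R12 x *\<^sub>v h x)) + w x \<bullet> ((E x)\<^sup>T *\<^sub>v k)
        + w x \<bullet> ((E x)\<^sup>T *\<^sub>v (C *\<^sub>v m))"
      using v1 v2 v3 wx unfolding inner
      by (simp add: scalar_prod_add_distrib[of _ n])
    also have "\<dots> = u x \<bullet> (R12 x *\<^sub>v h x) + e x \<bullet> k + e x \<bullet> (C *\<^sub>v m)"
      unfolding u_def e_def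
      by (simp only: scalar_prod_transpose_mult[OF carriers(1) wx Rh]
          scalar_prod_transpose_mult[OF carriers(3) wx k]
          scalar_prod_transpose_mult[OF carriers(3) wx Cm])
    finally show ?thesis
      by (simp add: comm_scalar_prod[OF ex k] comm_scalar_prod[OF ex Cm])
  qed
  have R22h: "(\<lambda>x. R22 x *\<^sub>v h x) \<in> L2 r a b"
    by (intro continuous_mat_on_mult_L2[OF R22] h_L2)
  have Cm: "C *\<^sub>v m \<in> carrier_vec q"
    using C m by (rule mult_mat_vec_carrier)
  have int1: "set_integrable lebesgue {a<..<b} (\<lambda>x. u x \<bullet> (R12 x *\<^sub>v h x))"
    by (intro L2_inner_integrable[OF u] continuous_mat_on_mult_L2[OF R12] h_L2)
  have int2: "set_integrable lebesgue {a<..<b} (\<lambda>x. h x \<bullet> (R21 x *\<^sub>v u x))"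
    by (intro L2_inner_integrable[OF h_L2] R21u)
  have int3: "set_integrable lebesgue {a<..<b} (\<lambda>x. h x \<bullet> (R22 x *\<^sub>v h x))"
    by (intro L2_inner_integrable[OF h_L2] R22h)
  \<comment> \<open>The two constants become integrals again, with \<open>m\<close> moved inside to form \<open>h\<close>.\<close>
  have "k \<bullet> m = m \<bullet> k"
    by (rule comm_scalar_prod[OF k m])
  also have "\<dots> = (LINT x:{a<..<b}|lebesgue. m \<bullet> c x)"
    unfolding k_def by (rule scalar_prod_vec_integral[OF m c])
  also have "\<dots> = (LINT x:{a<..<b}|lebesgue. h x \<bullet> (R21 x *\<^sub>v u x))"
    unfolding c_def h_eq
    using scalar_prod_transpose_mult[OF carriers(2) m L2_carrier[OF R21u]]
    by (intro set_lebesgue_integral_cong) auto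
  finally have km: "k \<bullet> m = (LINT x:{a<..<b}|lebesgue. h x \<bullet> (R21 x *\<^sub>v u x))" .
  have Gm: "(\<lambda>z. G z *\<^sub>v m) \<in> L2 q a b"
    by (intro continuous_mat_on_mult_L2[OF G] L2_const m)
  have "(C *\<^sub>v m) \<bullet> m = m \<bullet> (C *\<^sub>v m)"
    by (rule comm_scalar_prod[OF Cm m])
  also have "\<dots> = (LINT z:{a<..<b}|lebesgue. m \<bullet> (G z *\<^sub>v m))"
    unfolding C_def mat_integral_mult_vec[OF G m] by (rule scalar_prod_vec_integral[OF m Gm])
  also have "\<dots> = (LINT z:{a<..<b}|lebesgue. h z \<bullet> (R22 z *\<^sub>v h z))"
  proof (intro set_lebesgue_integral_cong allI impI)
    fix z assume z: "z \<in> {a<..<b}"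
    have DT: "(D z)\<^sup>T \<in> carrier_mat q r"
      using carriers by simp
    have "G z *\<^sub>v m = (D z)\<^sup>T *\<^sub>v (R22 z *\<^sub>v h z)"
      unfolding G_def h_eq
      by (simp only: assoc_mult_mat_vec[OF mult_carrier_mat[OF DT carriers(6)] carriers(2) m]
          assoc_mult_mat_vec[OF DT carriers(6) mult_mat_vec_carrier[OF carriers(2) m]])
    then show "m \<bullet> (G z *\<^sub>v m) = h z \<bullet> (R22 z *\<^sub>v h z)"
      by (simp only: scalar_prod_transpose_mult[OF carriers(2) m L2_carrier[OF R22h z]]
          h_eq[symmetric])
  qed simp
  finally have Cmm: "(C *\<^sub>v m) \<bullet> m = (LINT z:{a<..<b}|lebesgue. h z \<bullet> (R22 z *\<^sub>v h z))" .
  have "(LINT x:{a<..<b}|lebesgue. w x \<bullet> vec_integral n a b (\<lambda>y. N x y *\<^sub>v w y)) =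
      (LINT x:{a<..<b}|lebesgue. u x \<bullet> (R12 x *\<^sub>v h x) + k \<bullet> e x + (C *\<^sub>v m) \<bullet> e x)"
    using outer by (intro set_lebesgue_integral_cong) auto
  also have "\<dots> = (LINT x:{a<..<b}|lebesgue. u x \<bullet> (R12 x *\<^sub>v h x))
      + (LINT x:{a<..<b}|lebesgue. k \<bullet> e x) + (LINT x:{a<..<b}|lebesgue. (C *\<^sub>v m) \<bullet> e x)"
    using int1 L2_inner_integrable[OF L2_const[OF k] e] L2_inner_integrable[OF L2_const[OF Cm] e]
    by simp
  also have "\<dots> = (LINT x:{a<..<b}|lebesgue. u x \<bullet> (R12 x *\<^sub>v h x)) + k \<bullet> m + (C *\<^sub>v m) \<bullet> m"
    unfolding m_def[symmetric] scalar_prod_vec_integral[OF k e, symmetric]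
      scalar_prod_vec_integral[OF Cm e, symmetric] ..
  also have "\<dots> = (LINT x:{a<..<b}|lebesgue. u x \<bullet> (R12 x *\<^sub>v h x)
      + h x \<bullet> (R21 x *\<^sub>v u x) + h x \<bullet> (R22 x *\<^sub>v h x))"
    using int1 int2 int3 by (simp add: km Cmm)
  finally show ?thesis
    unfolding u_def .
qed

section \<open>Positive semidefinite block matrices\<close>

text \<open>This is the form of \<open>P\<close> at the stacked vector \<open>u @\<^sub>v v\<close>, written out by blocks.\<close>

lemma psd_block_form_nonneg:
  assumes "psd P" "P \<in> symmetric_mats (s + t)"
    and split: "split_block P s s = (P11, P12, P21, P22)"
    and u: "u \<in> carrier_vec s" and v: "v \<in> carrier_vec t"
  shows "0 \<le> u \<bullet> (P11 *\<^sub>v u) + u \<bullet> (P12 *\<^sub>v v) + v \<bullet> (P21 *\<^sub>v u) + v \<bullet> (P22 *\<^sub>v v)"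
proof -
  have dims: "dim_row P = s + t" "dim_col P = s + t"
    using assms(2) by (auto simp: symmetric_mats_def)
  note block = split_block[OF split dims]
  have "u @\<^sub>v v \<in> carrier_vec (s + t)"
    using u v by simp
  then have "0 \<le> (u @\<^sub>v v) \<bullet> (P *\<^sub>v (u @\<^sub>v v))"
    using assms(1) dims by (simp add: psd_def)
  also have "P *\<^sub>v (u @\<^sub>v v) = (P11 *\<^sub>v u + P12 *\<^sub>v v) @\<^sub>v (P21 *\<^sub>v u + P22 *\<^sub>v v)"
    unfolding block(5) by (rule four_block_mat_mult_vec[OF block(1-4) u v])
  also have "(u @\<^sub>v v) \<bullet> \<dots> = u \<bullet> (P11 *\<^sub>v u + P12 *\<^sub>v v) + v \<bullet> (P21 *\<^sub>v u + P22 *\<^sub>v v)"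
    using block(1-4) u v by (intro scalar_prod_append[of _ s _ t])
      (auto intro!: add_carrier_vec mult_mat_vec_carrier)
  also have "u \<bullet> (P11 *\<^sub>v u + P12 *\<^sub>v v) = u \<bullet> (P11 *\<^sub>v u) + u \<bullet> (P12 *\<^sub>v v)"
    using block(1,2) u v by (intro scalar_prod_add_distrib[of _ s] mult_mat_vec_carrier)
  also have "v \<bullet> (P21 *\<^sub>v u + P22 *\<^sub>v v) = v \<bullet> (P21 *\<^sub>v u) + v \<bullet> (P22 *\<^sub>v v)"
    using block(3,4) u v by (intro scalar_prod_add_distrib[of _ t] mult_mat_vec_carrier)
  finally show ?thesis
    by simp
qed

lemma scalar_prod_add_smult_mult_vec:
  fixes A B :: "real Matrix.mat"
  assumes "A \<in> carrier_mat m n" "B \<in> carrier_mat m n" "u \<in> carrier_vec m" "v \<in> carrier_vec n"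
  shows "u \<bullet> ((A + c \<cdot>\<^sub>m B) *\<^sub>v v) = u \<bullet> (A *\<^sub>v v) + c * (u \<bullet> (B *\<^sub>v v))"
proof -
  have "(A + c \<cdot>\<^sub>m B) *\<^sub>v v = A *\<^sub>v v + c \<cdot>\<^sub>v (B *\<^sub>v v)"
    using assms by (subst add_mult_distrib_mat_vec[of _ m n]) auto
  moreover have "A *\<^sub>v v \<in> carrier_vec m" "B *\<^sub>v v \<in> carrier_vec m"
    using assms by (auto intro: mult_mat_vec_carrier)
  ultimately show ?thesis
    using assms by (simp add: scalar_prod_add_distrib[of _ m])
qed

section \<open>Monomial matrices\<close>

lemma continuous_mat_on_kronecker:
  assumes F: "continuous_mat_on S r c F" and B: "B \<in> carrier_mat k l"
  shows "continuous_mat_on S (r * k) (c * l) (\<lambda>x. F x \<otimes>\<^sub>K B)"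
proof -
  have carrier: "F x \<otimes>\<^sub>K B \<in> carrier_mat (r * k) (c * l)" for x
    using continuous_mat_on_carrier[OF F, of x] B by (simp add: kronecker_def)
  have "continuous_on S (\<lambda>x. (F x \<otimes>\<^sub>K B) $$ (i, j))" if ij: "i < r * k" "j < c * l" for i j
  proof -
    have "(F x \<otimes>\<^sub>K B) $$ (i, j) = F x $$ (i div k, j div l) * B $$ (i mod k, j mod l)" for x
      using continuous_mat_on_carrier[OF F, of x] B ij by (simp add: kronecker_def)
    moreover have "i div k < r" "j div l < c"
      using ij by (auto intro: less_mult_imp_div_less)
    ultimately show ?thesis
      using F by (auto simp: continuous_mat_on_def intro!: continuous_intros)
  qed
  with carrier show ?thesis
    by (simp add: continuous_mat_on_def)
qed

lemma continuous_mat_on_monomials1: "continuous_mat_on S (d + 1) 1 (monomials1 d)"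
  by (auto simp: continuous_mat_on_def monomials1_def intro!: continuous_intros)

lemma continuous_mat_on_monomials2:
  "continuous_mat_on S (length (exponents2 d)) 1 (\<lambda>y. monomials2 d x y)"
  by (auto simp: continuous_mat_on_def monomials2_def intro!: continuous_intros)

lemma continuous_mat_on_mat_diag:
  fixes f :: "real \<Rightarrow> nat \<Rightarrow> real"
  assumes "\<And>i. i < n \<Longrightarrow> continuous_on S (\<lambda>x. f x i)"
  shows "continuous_mat_on S n n (\<lambda>x. mat_diag n (f x))"
proof -
  have "continuous_on S (\<lambda>x. if i = j then f x j else 0)" if "j < n" for i j
    using assms[OF that] by (cases "i = j") auto
  then show ?thesis
    by (simp add: continuous_mat_on_def mat_diag_def)
qed

text \<open>The index \<open>i div n\<close> is the position of the monomial to which row \<open>i\<close> of the Kronecker product with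
  \<open>1\<^sub>m n\<close> belongs.\<close>

definition first_variable_diag :: "nat \<Rightarrow> nat \<Rightarrow> real \<Rightarrow> real Matrix.mat" where
  "first_variable_diag n d x =
     mat_diag (length (exponents2 d) * n) (\<lambda>i. x ^ fst (exponents2 d ! (i div n)))"

text \<open>Separation of variables: each monomial \<open>x\<^sup>i y\<^sup>j\<close> is \<open>x\<^sup>i\<close> times its value at \<open>x = 1\<close>.\<close>

lemma monomials2_kronecker_factor:
  "monomials2 d x y \<otimes>\<^sub>K 1\<^sub>m n = first_variable_diag n d x * (monomials2 d 1 y \<otimes>\<^sub>K 1\<^sub>m n)"
proof -
  have carrier: "monomials2 d x y \<otimes>\<^sub>K 1\<^sub>m n \<in> carrier_mat (length (exponents2 d) * n) n" for x
    by (simp add: kronecker_def monomials2_def)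
  show ?thesis
    unfolding first_variable_diag_def mat_diag_mult_left[OF carrier]
  proof (rule eq_matI)
    fix i j
    assume "i < dim_row (Matrix.mat (length (exponents2 d) * n) n (\<lambda>(i, j).
          x ^ fst (exponents2 d ! (i div n)) * (monomials2 d 1 y \<otimes>\<^sub>K 1\<^sub>m n) $$ (i, j)))"
      and "j < dim_col (Matrix.mat (length (exponents2 d) * n) n (\<lambda>(i, j).
          x ^ fst (exponents2 d ! (i div n)) * (monomials2 d 1 y \<otimes>\<^sub>K 1\<^sub>m n) $$ (i, j)))"
    then have i: "i < length (exponents2 d) * n" and j: "j < n" by auto
    then have "i div n < length (exponents2 d)"
      by (auto intro: less_mult_imp_div_less)
    with i j show "(monomials2 d x y \<otimes>\<^sub>K 1\<^sub>m n) $$ (i, j) =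
        Matrix.mat (length (exponents2 d) * n) n (\<lambda>(i, j).
          x ^ fst (exponents2 d ! (i div n)) * (monomials2 d 1 y \<otimes>\<^sub>K 1\<^sub>m n) $$ (i, j)) $$ (i, j)"
      by (simp add: kronecker_def monomials2_def)
  qed (use carrier in auto)
qed

lemma continuous_mat_on_first_variable_diag:
  "continuous_mat_on S (length (exponents2 d) * n) (length (exponents2 d) * n)
     (first_variable_diag n d)"
  unfolding first_variable_diag_def[abs_def]
  by (intro continuous_mat_on_mat_diag continuous_intros)

section \<open>Positivity of the functional\<close>

theorem theorem3:
  fixes n d :: nat and a b \<epsilon> :: real
    and P Q P11 P12 P21 P22 Q11 Q12 Q21 Q22 :: "real Matrix.mat"
    and g :: "real \<Rightarrow> real"
    and Z1 M :: "real \<Rightarrow> real Matrix.mat"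
    and Z2 N :: "real \<Rightarrow> real \<Rightarrow> real Matrix.mat"
    and V :: "(real \<Rightarrow> real Matrix.vec) \<Rightarrow> real"
  assumes "n \<ge> 1" and "a < b"
    and "P \<in> symmetric_mats (n * (d + 1) * (d + 4) div 2)" and "psd P"
    and "Q \<in> symmetric_mats (n * (d + 1) * (d + 4) div 2)" and "psd Q"
    and "split_block P (n * (d + 1)) (n * (d + 1)) = (P11, P12, P21, P22)"
    and "split_block Q (n * (d + 1)) (n * (d + 1)) = (Q11, Q12, Q21, Q22)"
    and "\<And>x. g x = (x - a) * (b - x)"
    and "\<And>x. Z1 x = monomials1 d x \<otimes>\<^sub>K 1\<^sub>m n"
    and "\<And>x y. Z2 x y = monomials2 d x y \<otimes>\<^sub>K 1\<^sub>m n"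
    and "\<epsilon> > 0"
    and "\<And>x. M x = (Z1 x)\<^sup>T * (P11 + g x \<cdot>\<^sub>m Q11) * Z1 x + \<epsilon> \<cdot>\<^sub>m 1\<^sub>m n"
    and "\<And>x y. N x y =
           (Z1 x)\<^sup>T * (P12 + g x \<cdot>\<^sub>m Q12) * Z2 x y
         + (Z2 y x)\<^sup>T * (P21 + g y \<cdot>\<^sub>m Q21) * Z1 y
         + mat_integral n n a b (\<lambda>z. (Z2 z x)\<^sup>T * (P22 + g z \<cdot>\<^sub>m Q22) * Z2 z y)"
    and "\<And>w. w \<in> L2 n a b \<Longrightarrow> V w =
           (LINT x:{a<..<b}|lebesgue. w x \<bullet> (M x *\<^sub>v w x))
         + (LINT x:{a<..<b}|lebesgue. w x \<bullet> vec_integral n a b (\<lambda>y. N x y *\<^sub>v w y))"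
  shows "\<forall>w \<in> L2 n a b. V w \<ge> \<epsilon> * (L2_norm a b w)\<^sup>2"
proof
  fix w assume w: "w \<in> L2 n a b"
  define p where "p = (d + 1) * n"
  define q where "q = length (exponents2 d) * n"
  define D where "D = first_variable_diag n d"
  define E where "E y = monomials2 d 1 y \<otimes>\<^sub>K 1\<^sub>m n" for y
  define u where "u x = Z1 x *\<^sub>v w x" for x
  define h where "h x = D x *\<^sub>v vec_integral q a b (\<lambda>y. E y *\<^sub>v w y)" for x
  \<comment> \<open>The second block has size \<open>n (d + 1) (d + 2) / 2\<close>; parity makes the truncating divisions exact,
    so that both blocks fill the matrices.\<close>
  have "even ((d + 1) * (d + 2))" by simp
  then obtain l where l: "(d + 1) * (d + 2) = 2 * l" by (rule evenE)
  have q: "q = l * n"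
    unfolding q_def length_exponents2 l by simp
  have "n * (d + 1) * (d + 4) = n * (2 * (d + 1) + (d + 1) * (d + 2))"
    by (simp add: algebra_simps)
  also have "\<dots> = 2 * (p + q)"
    unfolding l q p_def by (simp add: algebra_simps)
  finally have size: "n * (d + 1) * (d + 4) div 2 = p + q" by simp
  have p: "n * (d + 1) = p" by (simp add: p_def)
  have P: "P \<in> symmetric_mats (p + q)" "split_block P p p = (P11, P12, P21, P22)"
    and Q: "Q \<in> symmetric_mats (p + q)" "split_block Q p p = (Q11, Q12, Q21, Q22)"
    using assms(3,5,7,8) unfolding size unfolding p by auto
  have dims: "dim_row P = p + q" "dim_col P = p + q" "dim_row Q = p + q" "dim_col Q = p + q"
    using P(1) Q(1) by (auto simp: symmetric_mats_def)
  note PB = split_block(1-4)[OF P(2) dims(1,2)] and QB = split_block(1-4)[OF Q(2) dims(3,4)]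
  have R: "continuous_mat_on {a..b} nr nc (\<lambda>x. A + g x \<cdot>\<^sub>m B)"
    if "A \<in> carrier_mat nr nc" "B \<in> carrier_mat nr nc" for A B nr nc
    using that unfolding assms(9) by (intro continuous_mat_on_add_smult continuous_intros)
  note R11 = R[OF PB(1) QB(1)] and R12 = R[OF PB(2) QB(2)]
    and R21 = R[OF PB(3) QB(3)] and R22 = R[OF PB(4) QB(4)]
  have Z1: "continuous_mat_on {a..b} p n Z1"
    using continuous_mat_on_kronecker[OF continuous_mat_on_monomials1[of "{a..b}" d]
        one_carrier_mat[of n]]
    by (simp add: p_def assms(10)[abs_def])
  have D: "continuous_mat_on {a..b} q q D"
    unfolding D_def q_def by (rule continuous_mat_on_first_variable_diag)
  have E: "continuous_mat_on {a..b} q n E"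
    using continuous_mat_on_kronecker[OF continuous_mat_on_monomials2[of "{a..b}" d 1]
        one_carrier_mat[of n]]
    by (simp add: q_def E_def[abs_def])
  have Z2: "Z2 x y = D x * E y" for x y
    unfolding assms(11) D_def E_def by (rule monomials2_kronecker_factor)
  have u: "u \<in> L2 p a b"
    unfolding u_def[abs_def] by (rule continuous_mat_on_mult_L2[OF Z1 w])
  have h: "h \<in> L2 q a b"
    unfolding h_def[abs_def]
    by (intro continuous_mat_on_mult_L2[OF D] L2_const vec_integral_carrier)
  have multiplier: "w x \<bullet> (M x *\<^sub>v w x) = u x \<bullet> ((P11 + g x \<cdot>\<^sub>m Q11) *\<^sub>v u x) + \<epsilon> * (w x \<bullet> w x)"
    if x: "x \<in> {a<..<b}" for x
  proof -
    have wx: "w x \<in> carrier_vec n" and ux: "u x \<in> carrier_vec p"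
      using L2_carrier[OF w x] L2_carrier[OF u x] by auto
    note Zx = continuous_mat_on_carrier[OF Z1, of x]
      and Rx = continuous_mat_on_carrier[OF R11, of x]
    have ZT: "(Z1 x)\<^sup>T \<in> carrier_mat n p" using Zx by simp
    note ZR = mult_carrier_mat[OF ZT Rx]
    have "w x \<bullet> (M x *\<^sub>v w x) =
        w x \<bullet> (((Z1 x)\<^sup>T * (P11 + g x \<cdot>\<^sub>m Q11) * Z1 x) *\<^sub>v w x) + \<epsilon> * (w x \<bullet> (1\<^sub>m n *\<^sub>v w x))"
      unfolding assms(13)
      by (rule scalar_prod_add_smult_mult_vec[OF mult_carrier_mat[OF ZR Zx] one_carrier_mat wx wx])
    also have "((Z1 x)\<^sup>T * (P11 + g x \<cdot>\<^sub>m Q11) * Z1 x) *\<^sub>v w x =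
        (Z1 x)\<^sup>T *\<^sub>v ((P11 + g x \<cdot>\<^sub>m Q11) *\<^sub>v u x)"
      unfolding assoc_mult_mat_vec[OF ZR Zx wx] u_def[symmetric]
      by (rule assoc_mult_mat_vec[OF ZT Rx ux])
    also have "w x \<bullet> \<dots> = u x \<bullet> ((P11 + g x \<cdot>\<^sub>m Q11) *\<^sub>v u x)"
      by (simp only: scalar_prod_transpose_mult[OF Zx wx mult_mat_vec_carrier[OF Rx ux]]
          u_def[symmetric])
    finally show ?thesis
      using wx by simp
  qed
  \<comment> \<open>\<open>F\<close> collects the three blocks that the kernel contributes.\<close>
  define F where "F x = u x \<bullet> ((P12 + g x \<cdot>\<^sub>m Q12) *\<^sub>v h x)
     + h x \<bullet> ((P21 + g x \<cdot>\<^sub>m Q21) *\<^sub>v u x) + h x \<bullet> ((P22 + g x \<cdot>\<^sub>m Q22) *\<^sub>v h x)" for x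
  have kernel: "(LINT x:{a<..<b}|lebesgue. w x \<bullet> vec_integral n a b (\<lambda>y. N x y *\<^sub>v w y)) =
      (LINT x:{a<..<b}|lebesgue. F x)"
    unfolding F_def u_def
    by (rule separable_kernel_form[OF Z1 D E R12 R21 R22 w assms(14)[unfolded Z2] h_def])
  have ww: "set_integrable lebesgue {a<..<b} (\<lambda>x. w x \<bullet> w x)"
    by (rule L2_inner_integrable[OF w w])
  have F: "set_integrable lebesgue {a<..<b} F"
    unfolding F_def[abs_def]
    by (intro set_integral_add(1) L2_inner_integrable[OF u] L2_inner_integrable[OF h]
        continuous_mat_on_mult_L2[OF R12] continuous_mat_on_mult_L2[OF R21]
        continuous_mat_on_mult_L2[OF R22] u h)
  have F11: "set_integrable lebesgue {a<..<b} (\<lambda>x. u x \<bullet> ((P11 + g x \<cdot>\<^sub>m Q11) *\<^sub>v u x))"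
    by (intro L2_inner_integrable[OF u] continuous_mat_on_mult_L2[OF R11] u)
  have nonneg: "0 \<le> u x \<bullet> ((P11 + g x \<cdot>\<^sub>m Q11) *\<^sub>v u x) + F x" if x: "x \<in> {a<..<b}" for x
  proof -
    have ux: "u x \<in> carrier_vec p" and hx: "h x \<in> carrier_vec q"
      using L2_carrier[OF u x] L2_carrier[OF h x] by auto
    have "0 \<le> g x"
      using x by (simp add: assms(9))
    note psd_block_form_nonneg[OF assms(4) P ux hx]
      mult_nonneg_nonneg[OF \<open>0 \<le> g x\<close> psd_block_form_nonneg[OF assms(6) Q ux hx]]
    then show ?thesis
      unfolding F_def scalar_prod_add_smult_mult_vec[OF PB(1) QB(1) ux ux]
        scalar_prod_add_smult_mult_vec[OF PB(2) QB(2) ux hx]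
        scalar_prod_add_smult_mult_vec[OF PB(3) QB(3) hx ux]
        scalar_prod_add_smult_mult_vec[OF PB(4) QB(4) hx hx]
      by (simp add: distrib_left)
  qed
  have "0 \<le> (LINT x:{a<..<b}|lebesgue. w x \<bullet> w x)"
    unfolding set_lebesgue_integral_def
    by (intro Bochner_Integration.integral_nonneg) (auto simp: indicator_def scalar_prod_def intro!: sum_nonneg)
  then have "\<epsilon> * (L2_norm a b w)\<^sup>2 = \<epsilon> * (LINT x:{a<..<b}|lebesgue. w x \<bullet> w x)"
    by (simp add: L2_norm_def)
  also have "\<dots> = (LINT x:{a<..<b}|lebesgue. \<epsilon> * (w x \<bullet> w x))"
    by simp
  also have "\<dots> \<le> (LINT x:{a<..<b}|lebesgue.
      u x \<bullet> ((P11 + g x \<cdot>\<^sub>m Q11) *\<^sub>v u x) + \<epsilon> * (w x \<bullet> w x) + F x)"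
    using nonneg by (intro set_integral_mono set_integral_add(1) F11 F set_integrable_mult_right ww)
      (auto simp: algebra_simps)
  also have "\<dots> = (LINT x:{a<..<b}|lebesgue.
      u x \<bullet> ((P11 + g x \<cdot>\<^sub>m Q11) *\<^sub>v u x) + \<epsilon> * (w x \<bullet> w x)) + (LINT x:{a<..<b}|lebesgue. F x)"
    by (intro set_integral_add set_integrable_mult_right F11 F ww)
  also have "(LINT x:{a<..<b}|lebesgue.
      u x \<bullet> ((P11 + g x \<cdot>\<^sub>m Q11) *\<^sub>v u x) + \<epsilon> * (w x \<bullet> w x)) =
      (LINT x:{a<..<b}|lebesgue. w x \<bullet> (M x *\<^sub>v w x))"
    using multiplier by (intro set_lebesgue_integral_cong) auto
  also have "\<dots> + (LINT x:{a<..<b}|lebesgue. F x) = V w"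
    unfolding assms(15)[OF w] kernel ..
  finally show "V w \<ge> \<epsilon> * (L2_norm a b w)\<^sup>2" .
qed

end
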